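(* $\mathbf{K_F}$ is semi-complete with respect to the class of all EGL-models: for every formula $\varphi$, if $\varphi$ is valid (true in every EGL-model), then $\vdash_{\mathbf{K_F}}\neg\neg\varphi$.
   Context: Fix a set $\mathcal P$ of atomic propositions and a set $\mathcal A$ of agents. Formulas: $\varphi ::= p \mid \bot \mid \varphi\wedge\varphi \mid \varphi\to\varphi \mid B_a\varphi$ with $p\in\mathcal P$, $a\in\mathcal A$; $\neg\varphi=\varphi\to\bot$. An EGL-model (model) is $M=(S,(r_a)_{a\in\mathcal A},\pi)$ where $S$ is a non-empty countable set, each $r_a:S\times S\to[0,1]$, and $\pi:S\times\mathcal P\to[0,1]$. Values: $V_s(p)=\pi(s,p)$; $V_s(\bot)=0$; $V_s(\varphi\wedge\psi)=\min\{V_s(\varphi),V_s(\psi)\}$; $V_s(\varphi\to\psi)=1$ if $V_s(\varphi)\le V_s(\psi)$ and $=V_s(\psi)$ otherwise; $V_s(B_a\varphi)=\inf_{s'\in S}\max\{1-r_a(s,s'),V_{s'}(\varphi)\}$. $\varphi$ is true in $M$ if $V_s(\varphi)=1$ for all $s\in S$; $\varphi$ is valid if true in all models. $\mathbf{K_F}$ has as axioms (A) all instances of tautologies of propositional Gödel logic and (K) $B_a(\varphi\to\psi)\to(B_a\varphi\to B_a\psi)$, and as rules (R1) modus ponens and (R2) from $\varphi$ infer $B_a\varphi$. $\vdash_{\mathbf{K_F}}\varphi$ means there is a finite sequence of formulas ending in $\varphi$ each of which is an axiom or is obtained from earlier ones by (R1) or (R2), with the restriction that (R2) cannot be applied to non-valid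 formulas. *)

theory Defs
  imports Complex_Main "HOL-Library.Countable_Set"
begin

section \<open>Syntax\<close>

datatype ('p, 'a) fm =
    Atom 'p
  | Bot
  | And "('p, 'a) fm" "('p, 'a) fm"
  | Imp "('p, 'a) fm" "('p, 'a) fm"
  | Bel 'a "('p, 'a) fm"

abbreviation Neg :: "('p, 'a) fm \<Rightarrow> ('p, 'a) fm" where
  "Neg \<phi> \<equiv> Imp \<phi> Bot"

section \<open>EGL-models\<close>

definition godel_imp :: "real \<Rightarrow> real \<Rightarrow> real" where
  "godel_imp x y = (if x \<le> y then 1 else y)"

record ('s, 'p, 'a) egl =
  states :: "'s set"
  acc :: "'a \<Rightarrow> 's \<Rightarrow> 's \<Rightarrow> real"
  val :: "'s \<Rightarrow> 'p \<Rightarrow> real"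

definition egl_model :: "('s, 'p, 'a) egl \<Rightarrow> bool" where
  "egl_model M \<longleftrightarrow>
     states M \<noteq> {} \<and> countable (states M) \<and>
     (\<forall>a. \<forall>s\<in>states M. \<forall>s'\<in>states M. acc M a s s' \<in> {0..1}) \<and>
     (\<forall>s\<in>states M. \<forall>p. val M s p \<in> {0..1})"

primrec fm_value :: "('s, 'p, 'a) egl \<Rightarrow> 's \<Rightarrow> ('p, 'a) fm \<Rightarrow> real" where
  "fm_value M s (Atom p) = val M s p"
| "fm_value M s Bot = 0"
| "fm_value M s (And \<phi> \<psi>) = min (fm_value M s \<phi>) (fm_value M s \<psi>)"
| "fm_value M s (Imp \<phi> \<psi>) = godel_imp (fm_value M s \<phi>) (fm_value M s \<psi>)"
| "fm_value M s (Bel a \<phi>) =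
     (INF s'\<in>states M. max (1 - acc M a s s') (fm_value M s' \<phi>))"

definition true_in :: "('s, 'p, 'a) egl \<Rightarrow> ('p, 'a) fm \<Rightarrow> bool" where
  "true_in M \<phi> \<longleftrightarrow> (\<forall>s\<in>states M. fm_value M s \<phi> = 1)"

text \<open>
  A definition cannot quantify over the type of states.  State sets are countable, so every model
  is isomorphic to one whose states form a non-empty, finite or infinite, set of natural numbers;
  \<open>valid_true_in\<close> below shows that truth in these gives truth in the models over every state type.
\<close>

definition valid :: "('p, 'a) fm \<Rightarrow> bool" where
  "valid \<phi> \<longleftrightarrow> (\<forall>M :: (nat, 'p, 'a) egl. egl_model M \<longrightarrow> true_in M \<phi>)"

lemma valid_true_in:
  fixes M :: "('s, 'p, 'a) egl"
  assumes "valid \<phi>" and M: "egl_model M"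
  shows "true_in M \<phi>"
proof -
  let ?f = "to_nat_on (states M)" and ?g = "from_nat_into (states M)"
  define N :: "(nat, 'p, 'a) egl" where
    "N = \<lparr>states = ?f ` states M, acc = (\<lambda>a m n. acc M a (?g m) (?g n)), val = (\<lambda>n. val M (?g n))\<rparr>"
  have gf: "?g (?f s) = s" if "s \<in> states M" for s
    using M that by (simp add: egl_model_def)
  have "egl_model N"
    using M by (auto simp: egl_model_def N_def gf)
  then have "true_in N \<phi>"
    using assms(1) by (simp add: valid_def)
  moreover have "fm_value N (?f s) \<psi> = fm_value M s \<psi>" if "s \<in> states M" for s \<psi>
    using that
  proof (induction \<psi> arbitrary: s)
    case (Bel a \<psi>)
    have "(\<lambda>n. max (1 - acc N a (?f s) n) (fm_value N n \<psi>)) ` states N =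
      (\<lambda>s'. max (1 - acc M a s s') (fm_value M s' \<psi>)) ` states M"
      using Bel by (force simp: N_def gf image_image intro!: image_cong)
    then show ?case by simp
  qed (simp_all add: N_def gf)
  ultimately show ?thesis
    by (simp add: true_in_def N_def)
qed

section \<open>Instances of tautologies of propositional Goedel logic\<close>

datatype pfm = PVar nat | PBot | PAnd pfm pfm | PImp pfm pfm

primrec pvalue :: "(nat \<Rightarrow> real) \<Rightarrow> pfm \<Rightarrow> real" where
  "pvalue v (PVar n) = v n"
| "pvalue v PBot = 0"
| "pvalue v (PAnd \<alpha> \<beta>) = min (pvalue v \<alpha>) (pvalue v \<beta>)"
| "pvalue v (PImp \<alpha> \<beta>) = godel_imp (pvalue v \<alpha>) (pvalue v \<beta>)"

definition godel_tautology :: "pfm \<Rightarrow> bool" where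
  "godel_tautology \<alpha> \<longleftrightarrow> (\<forall>v. (\<forall>n. v n \<in> {0..1}) \<longrightarrow> pvalue v \<alpha> = 1)"

primrec pinst :: "(nat \<Rightarrow> ('p, 'a) fm) \<Rightarrow> pfm \<Rightarrow> ('p, 'a) fm" where
  "pinst \<sigma> (PVar n) = \<sigma> n"
| "pinst \<sigma> PBot = Bot"
| "pinst \<sigma> (PAnd \<alpha> \<beta>) = And (pinst \<sigma> \<alpha>) (pinst \<sigma> \<beta>)"
| "pinst \<sigma> (PImp \<alpha> \<beta>) = Imp (pinst \<sigma> \<alpha>) (pinst \<sigma> \<beta>)"

section \<open>The system \<open>K\<^sub>F\<close>\<close>

inductive KF_axiom :: "('p, 'a) fm \<Rightarrow> bool" where
  A: "godel_tautology \<alpha> \<Longrightarrow> KF_axiom (pinst \<sigma> \<alpha>)"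
| K: "KF_axiom (Imp (Bel a (Imp \<phi> \<psi>)) (Imp (Bel a \<phi>) (Bel a \<psi>)))"

definition KF_derivation :: "('p, 'a) fm list \<Rightarrow> bool" where
  "KF_derivation \<phi>s \<longleftrightarrow>
     (\<forall>i<length \<phi>s.
        KF_axiom (\<phi>s ! i) \<or>
        (\<exists>j<i. \<exists>k<i. \<phi>s ! k = Imp (\<phi>s ! j) (\<phi>s ! i)) \<or>
        (\<exists>j<i. \<exists>a. valid (\<phi>s ! j) \<and> \<phi>s ! i = Bel a (\<phi>s ! j)))"

definition KF_provable :: "('p, 'a) fm \<Rightarrow> bool" where
  "KF_provable \<phi> \<longleftrightarrow> (\<exists>\<phi>s. KF_derivation \<phi>s \<and> \<phi>s \<noteq> [] \<and> last \<phi>s = \<phi>)"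

end

theory Submission
  imports Defs
begin

text \<open>
  In fact every valid formula is provable, and \<open>\<phi> \<rightarrow> \<not>\<not>\<phi>\<close> is a tautology.  Completeness is proved by
  induction on the modal depth of \<open>\<phi>\<close>.  If \<open>\<phi>\<close> is not provable, some propositional valuation \<open>v\<close> of
  its atoms and outermost boxed subformulas gives \<open>\<phi>\<close> a value \<open>t < 1\<close> and gives a value above \<open>t\<close>
  to all theorems \<open>B\<^sub>a \<psi>\<^sub>1 \<rightarrow> \<dots> \<rightarrow> B\<^sub>a \<psi>\<^sub>n \<rightarrow> B\<^sub>a \<chi>\<close> obtained from valid formulas
  \<open>\<psi>\<^sub>1 \<rightarrow> \<dots> \<rightarrow> \<psi>\<^sub>n \<rightarrow> \<chi>\<close>, which are provable by the induction hypothesis.  So if \<open>v (B\<^sub>a \<chi>) \<le> t\<close>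
  and the \<open>\<psi>\<^sub>i\<close> are the formulas with \<open>v (B\<^sub>a \<psi>\<^sub>i) > v (B\<^sub>a \<chi>)\<close>, then in some model all \<open>\<psi>\<^sub>i\<close> exceed
  \<open>\<chi>\<close> at some state.  Values can be transformed by any increasing homeomorphism of \<open>[0,1]\<close>, which
  moves \<open>\<chi>\<close> arbitrarily close to 0 and the \<open>\<psi>\<^sub>i\<close> close to 1.  Making these states accessible from a
  new root to degree \<open>1 - v (B\<^sub>a \<chi>)\<close> gives every \<open>B\<^sub>a \<psi>\<close> the value prescribed by \<open>v\<close> at the root,
  up to changes of values above \<open>t\<close>, and these do not affect the value \<open>t\<close> of \<open>\<phi>\<close>.
\<close>

section \<open>Derivations\<close>

lemma KF_provable_axiom: "KF_axiom \<phi> \<Longrightarrow> KF_provable \<phi>"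
  unfolding KF_provable_def KF_derivation_def by (rule exI[of _ "[\<phi>]"]) simp

lemma KF_derivation_append:
  assumes "KF_derivation xs" "KF_derivation ys"
  shows "KF_derivation (xs @ ys)"
  unfolding KF_derivation_def
proof (intro allI impI)
  fix i assume i: "i < length (xs @ ys)"
  let ?z = "xs @ ys" and ?n = "length xs"
  show "KF_axiom (?z ! i) \<or> (\<exists>j<i. \<exists>k<i. ?z ! k = Imp (?z ! j) (?z ! i)) \<or>
        (\<exists>j<i. \<exists>a. valid (?z ! j) \<and> ?z ! i = Bel a (?z ! j))"
  proof (cases "i < ?n")
    case True
    then have "?z ! j = xs ! j" if "j \<le> i" for j
      using that by (simp add: nth_append)
    then show ?thesis
      using assms(1) True unfolding KF_derivation_def by (metis less_imp_le order_refl)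
  next
    case False
    define m where "m = i - ?n"
    have m: "m < length ys" "i = ?n + m"
      using i False by (auto simp: m_def)
    consider "KF_axiom (ys ! m)"
      | j k where "j < m" "k < m" "ys ! k = Imp (ys ! j) (ys ! m)"
      | j a where "j < m" "valid (ys ! j)" "ys ! m = Bel a (ys ! j)"
      using assms(2) m(1) unfolding KF_derivation_def by blast
    then show ?thesis
    proof cases
      case 1
      then show ?thesis by (simp add: m(2))
    next
      case (2 j k)
      then have "?n + j < i" "?n + k < i" "?z ! (?n + k) = Imp (?z ! (?n + j)) (?z ! i)"
        by (auto simp: m(2))
      then show ?thesis by blast
    next
      case (3 j a)
      then have "?n + j < i" "valid (?z ! (?n + j))" "?z ! i = Bel a (?z ! (?n + j))"
        by (auto simp: m(2))
      then show ?thesis by blast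
    qed
  qed
qed

text \<open>Treats both rules at once. Premises are given by membership, since any member of
  \<open>xs\<close> precedes the appended formula.\<close>

lemma KF_derivation_snoc:
  assumes "KF_derivation xs"
    and "(\<exists>\<phi>\<in>set xs. Imp \<phi> \<psi> \<in> set xs) \<or> (\<exists>a. \<exists>\<phi>\<in>set xs. valid \<phi> \<and> \<psi> = Bel a \<phi>)"
  shows "KF_derivation (xs @ [\<psi>])"
  unfolding KF_derivation_def
proof (intro allI impI)
  fix i assume i: "i < length (xs @ [\<psi>])"
  let ?z = "xs @ [\<psi>]"
  show "KF_axiom (?z ! i) \<or> (\<exists>j<i. \<exists>k<i. ?z ! k = Imp (?z ! j) (?z ! i)) \<or>
        (\<exists>j<i. \<exists>a. valid (?z ! j) \<and> ?z ! i = Bel a (?z ! j))"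
  proof (cases "i < length xs")
    case True
    then have "?z ! j = xs ! j" if "j \<le> i" for j
      using that by (simp add: nth_append)
    then show ?thesis
      using assms(1) True unfolding KF_derivation_def by (metis less_imp_le order_refl)
  next
    case False
    then have z: "i = length xs" using i by simp
    have z2: "?z ! i = \<psi>"
      by (simp add: z)
    have mem: "\<exists>j<i. ?z ! j = \<phi>" if "\<phi> \<in> set xs" for \<phi>
      using that by (auto simp: in_set_conv_nth nth_append z)
    from assms(2) show ?thesis
    proof (elim disjE bexE exE conjE)
      fix \<phi> assume "\<phi> \<in> set xs" "Imp \<phi> \<psi> \<in> set xs"
      then obtain j k where "j < i" "k < i" "?z ! j = \<phi>" "?z ! k = Imp \<phi> \<psi>"
        using mem by blast
      then have "\<exists>j<i. \<exists>k<i. ?z ! k = Imp (?z ! j) (?z ! i)"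
        unfolding z2 by blast
      then show ?thesis by blast
    next
      fix a \<phi> assume "\<phi> \<in> set xs" "valid \<phi>" "\<psi> = Bel a \<phi>"
      then obtain j where "j < i" "valid (?z ! j)" "?z ! i = Bel a (?z ! j)"
        using mem z2 by metis
      then show ?thesis by blast
    qed
  qed
qed

lemma KF_provable_mp:
  assumes "KF_provable (Imp \<phi> \<psi>)" "KF_provable \<phi>"
  shows "KF_provable \<psi>"
proof -
  obtain xs ys where "KF_derivation xs" "xs \<noteq> []" "last xs = Imp \<phi> \<psi>"
    and "KF_derivation ys" "ys \<noteq> []" "last ys = \<phi>"
    using assms unfolding KF_provable_def by blast
  moreover from this have "Imp \<phi> \<psi> \<in> set (xs @ ys)" "\<phi> \<in> set (xs @ ys)"
    using last_in_set[of xs] last_in_set[of ys] by auto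
  ultimately have "KF_derivation ((xs @ ys) @ [\<psi>])"
    using KF_derivation_snoc[of "xs @ ys" \<psi>] KF_derivation_append by blast
  then show ?thesis
    unfolding KF_provable_def by (metis append_is_Nil_conv last_snoc not_Cons_self2)
qed

text \<open>The restriction on (R2) stays as a hypothesis; \<open>refuting_valuation\<close> boxes
  only formulas assumed valid.\<close>

lemma KF_provable_nec:
  assumes "KF_provable \<phi>" "valid \<phi>"
  shows "KF_provable (Bel a \<phi>)"
proof -
  obtain xs where "KF_derivation xs" "xs \<noteq> []" "last xs = \<phi>"
    using assms(1) unfolding KF_provable_def by blast
  moreover from this have "\<phi> \<in> set xs"
    using last_in_set[of xs] by auto
  ultimately have "KF_derivation (xs @ [Bel a \<phi>])"
    using KF_derivation_snoc[of xs "Bel a \<phi>"] assms(2) by blast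
  then show ?thesis
    unfolding KF_provable_def by (metis append_is_Nil_conv last_snoc not_Cons_self2)
qed

section \<open>Propositional reasoning over atoms and boxed formulas\<close>

text \<open>Propositional logic cannot look inside a box, so a boxed formula counts as a
  variable.\<close>

primrec prims :: "('p, 'a) fm \<Rightarrow> ('p, 'a) fm set" where
  "prims (Atom p) = {Atom p}"
| "prims Bot = {}"
| "prims (And \<phi> \<psi>) = prims \<phi> \<union> prims \<psi>"
| "prims (Imp \<phi> \<psi>) = prims \<phi> \<union> prims \<psi>"
| "prims (Bel a \<phi>) = {Bel a \<phi>}"

text \<open>Only the values of \<open>v\<close> at atoms and boxes matter. Taking \<open>v\<close>
  on all formulas lets \<open>fm_value M s\<close> itself serve as a valuation.\<close>

primrec gval :: "(('p, 'a) fm \<Rightarrow> real) \<Rightarrow> ('p, 'a) fm \<Rightarrow> real" where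
  "gval v (Atom p) = v (Atom p)"
| "gval v Bot = 0"
| "gval v (And \<phi> \<psi>) = min (gval v \<phi>) (gval v \<psi>)"
| "gval v (Imp \<phi> \<psi>) = godel_imp (gval v \<phi>) (gval v \<psi>)"
| "gval v (Bel a \<phi>) = v (Bel a \<phi>)"

primrec skeleton :: "(('p, 'a) fm \<Rightarrow> nat) \<Rightarrow> ('p, 'a) fm \<Rightarrow> pfm" where
  "skeleton e (Atom p) = PVar (e (Atom p))"
| "skeleton e Bot = PBot"
| "skeleton e (And \<phi> \<psi>) = PAnd (skeleton e \<phi>) (skeleton e \<psi>)"
| "skeleton e (Imp \<phi> \<psi>) = PImp (skeleton e \<phi>) (skeleton e \<psi>)"
| "skeleton e (Bel a \<phi>) = PVar (e (Bel a \<phi>))"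

lemma finite_prims: "finite (prims \<phi>)"
  by (induction \<phi>) auto

lemma prims_cases: "\<psi> \<in> prims \<phi> \<Longrightarrow> (\<exists>p. \<psi> = Atom p) \<or> (\<exists>a \<chi>. \<psi> = Bel a \<chi>)"
  by (induction \<phi>) auto

lemma finite_boxes: "finite {(a, \<psi>). Bel a \<psi> \<in> prims \<phi>}"
proof -
  have "inj (\<lambda>(a :: 'a, \<psi> :: ('p, 'a) fm). Bel a \<psi>)"
    by (auto simp: inj_on_def)
  then have "finite ((\<lambda>(a, \<psi>). Bel a \<psi>) -` prims \<phi>)"
    by (intro finite_vimageI finite_prims)
  then show ?thesis
    by (rule back_subst[where P = finite]) auto
qed

lemma pinst_skeleton:
  "(\<And>\<psi>. \<psi> \<in> prims \<phi> \<Longrightarrow> \<sigma> (e \<psi>) = \<psi>) \<Longrightarrow> pinst \<sigma> (skeleton e \<phi>) = \<phi>"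
  by (induction \<phi>) auto

lemma pvalue_skeleton: "pvalue u (skeleton e \<phi>) = gval (u \<circ> e) \<phi>"
  by (induction \<phi>) auto

text \<open>Numbering the finitely many members of \<open>prims \<phi>\<close> exhibits
  \<open>\<phi>\<close> as an instance of its skeleton, and a valuation \<open>u\<close> of the
  variables induces \<open>u \<circ> e\<close> on formulas. Propositional steps thus reduce to
  computing values.\<close>

lemma KF_provable_gval:
  assumes "\<And>v. range v \<subseteq> {0..1} \<Longrightarrow> gval v \<phi> = 1"
  shows "KF_provable \<phi>"
proof -
  let ?e = "to_nat_on (prims \<phi>)" and ?\<sigma> = "from_nat_into (prims \<phi>)"
  have "godel_tautology (skeleton ?e \<phi>)"
    unfolding godel_tautology_def pvalue_skeleton
    by (intro allI impI assms) auto
  then have "KF_axiom (pinst ?\<sigma> (skeleton ?e \<phi>))"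
    by (rule KF_axiom.A)
  moreover have "pinst ?\<sigma> (skeleton ?e \<phi>) = \<phi>"
    by (rule pinst_skeleton) (simp add: countable_finite finite_prims)
  ultimately show ?thesis
    by (simp add: KF_provable_axiom)
qed

lemma fm_value_gval: "fm_value M s \<phi> = gval (fm_value M s) \<phi>"
  by (induction \<phi>) auto

lemma gval_bounds: "range v \<subseteq> {0..1} \<Longrightarrow> gval v \<phi> \<in> {0..1}"
  by (induction \<phi>) (auto simp: godel_imp_def min_def image_subset_iff)

lemma gval_le_1: "range v \<subseteq> {0..1} \<Longrightarrow> gval v \<phi> \<le> 1"
  using gval_bounds[of v \<phi>] by simp

section \<open>Iterated implications\<close>

text \<open>Nested implications replace a conjunction of premises because (K) distributes a box over
  them directly.\<close>

definition Imps :: "('p, 'a) fm list \<Rightarrow> ('p, 'a) fm \<Rightarrow> ('p, 'a) fm" where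
  "Imps \<psi>s \<chi> = foldr Imp \<psi>s \<chi>"

lemma Imps_simps [simp]: "Imps [] \<chi> = \<chi>" "Imps (\<psi> # \<psi>s) \<chi> = Imp \<psi> (Imps \<psi>s \<chi>)"
  by (simp_all add: Imps_def)

text \<open>Used in the negative: a value other than 1 forces every premise strictly above
  \<open>\<chi>\<close>.\<close>

lemma gval_Imps:
  assumes "\<And>\<psi>. gval v \<psi> \<le> 1"
  shows "gval v (Imps \<psi>s \<chi>) = (if \<exists>\<psi>\<in>set \<psi>s. gval v \<psi> \<le> gval v \<chi> then 1 else gval v \<chi>)"
  by (induction \<psi>s) (use assms in \<open>auto simp: godel_imp_def intro: order_antisym\<close>)

lemma KF_provable_Imps_mp:
  "KF_provable (Imps \<psi>s \<chi>) \<Longrightarrow> (\<And>\<psi>. \<psi> \<in> set \<psi>s \<Longrightarrow> KF_provable \<psi>) \<Longrightarrow> KF_provable \<chi>"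
  by (induction \<psi>s) (auto intro: KF_provable_mp)

lemma KF_provable_Bel_Imps:
  "KF_provable (Imp (Bel a (Imps \<psi>s \<chi>)) (Imps (map (Bel a) \<psi>s) (Bel a \<chi>)))"
proof (induction \<psi>s)
  case Nil
  show ?case
    by (rule KF_provable_gval) (simp add: godel_imp_def)
next
  case (Cons \<psi> \<psi>s)
  let ?x = "Bel a (Imp \<psi> (Imps \<psi>s \<chi>))" and ?y = "Bel a \<psi>" and ?z = "Bel a (Imps \<psi>s \<chi>)"
  let ?w = "Imps (map (Bel a) \<psi>s) (Bel a \<chi>)"
  \<comment> \<open>Chaining: the first premise is an instance of (K), the second is the induction
    hypothesis.\<close>
  have "KF_provable (Imps [Imp ?x (Imp ?y ?z), Imp ?z ?w] (Imp ?x (Imp ?y ?w)))"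
    by (rule KF_provable_gval) (auto simp: godel_imp_def dest: gval_le_1)
  then have "KF_provable (Imp ?x (Imp ?y ?w))"
    by (rule KF_provable_Imps_mp)
      (use Cons.IH in \<open>auto intro: KF_provable_axiom KF_axiom.K\<close>)
  then show ?case by simp
qed

text \<open>Sending all values above \<open>t\<close> to 1 and fixing the others commutes with
  minimum and Goedel implication, because \<open>t < 1\<close>. The relation says that two values
  have the same image under this map.\<close>

lemma gval_collapse:
  assumes "\<And>\<psi>. \<psi> \<in> prims \<phi> \<Longrightarrow> u \<psi> = v \<psi> \<or> t < u \<psi> \<and> t < v \<psi>" "t < 1"
  shows "gval u \<phi> = gval v \<phi> \<or> t < gval u \<phi> \<and> t < gval v \<phi>"
  using assms(1)
proof (induction \<phi>)
  case (And \<phi> \<psi>)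
  then have "gval u \<phi> = gval v \<phi> \<or> t < gval u \<phi> \<and> t < gval v \<phi>"
    "gval u \<psi> = gval v \<psi> \<or> t < gval u \<psi> \<and> t < gval v \<psi>"
    by simp_all
  then show ?case by (auto simp: min_def)
next
  case (Imp \<phi> \<psi>)
  then have "gval u \<phi> = gval v \<phi> \<or> t < gval u \<phi> \<and> t < gval v \<phi>"
    "gval u \<psi> = gval v \<psi> \<or> t < gval u \<psi> \<and> t < gval v \<psi>"
    by simp_all
  then show ?case using assms(2) by (auto simp: godel_imp_def)
qed simp_all

section \<open>Transformations of models\<close>

lemma fm_value_bounds:
  assumes "egl_model M" "s \<in> states M"
  shows "fm_value M s \<phi> \<in> {0..1}"
  using assms(2)
proof (induction \<phi> arbitrary: s)
  case (Bel a \<phi>)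
  let ?f = "\<lambda>s'. max (1 - acc M a s s') (fm_value M s' \<phi>)"
  have f: "?f s' \<in> {0..1}" if "s' \<in> states M" for s'
    using assms(1) Bel that by (force simp: egl_model_def max_def)
  then have "bdd_below (?f ` states M)"
    by (intro bdd_belowI[of _ 0]) auto
  then have "(INF s'\<in>states M. ?f s') \<le> 1"
    using cINF_lower2[of ?f _ s 1] f Bel.prems by auto
  moreover have "0 \<le> (INF s'\<in>states M. ?f s')"
    using f Bel.prems by (intro cINF_greatest) auto
  ultimately show ?case by simp
qed (use assms(1) in \<open>auto simp: egl_model_def godel_imp_def min_def\<close>)

lemma Bel_bdd_below:
  assumes "egl_model M"
  shows "bdd_below ((\<lambda>s'. max (1 - acc M a s s') (fm_value M s' \<phi>)) ` states M)"
  by (rule bdd_belowI[of _ 0]) (use fm_value_bounds[OF assms] in \<open>force simp: le_max_iff_disj\<close>)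

section \<open>Changing the scale of truth values\<close>

text \<open>\<open>h\<close> acts on \<open>1 - acc M a s s'\<close>, the quantity that enters the
  value of a box.\<close>

definition rescale :: "(real \<Rightarrow> real) \<Rightarrow> ('s, 'p, 'a) egl \<Rightarrow> ('s, 'p, 'a) egl" where
  "rescale h M = \<lparr>states = states M, acc = (\<lambda>a s s'. 1 - h (1 - acc M a s s')),
     val = (\<lambda>s p. h (val M s p))\<rparr>"

lemma states_rescale [simp]: "states (rescale h M) = states M"
  by (simp add: rescale_def)

lemma rescale_model:
  assumes "egl_model M" "mono h" "h 0 = 0" "h 1 = 1"
  shows "egl_model (rescale h M)"
proof -
  have "h x \<in> {0..1}" if "x \<in> {0..1}" for x
    using monoD[OF assms(2), of 0 x] monoD[OF assms(2), of x 1] assms(3,4) that by auto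
  then show ?thesis
    using assms(1) unfolding egl_model_def rescale_def by simp
qed

text \<open>The connectives depend only on the order and on 0 and 1, which \<open>h\<close>
  preserves; continuity carries \<open>h\<close> through the infimum of a box.\<close>

lemma fm_value_rescale:
  assumes M: "egl_model M" and h: "strict_mono h" "h 0 = 0" "h 1 = 1"
    and cont: "\<And>x. isCont h x" and s: "s \<in> states M"
  shows "fm_value (rescale h M) s \<phi> = h (fm_value M s \<phi>)"
  using s
proof (induction \<phi> arbitrary: s)
  case (And \<phi> \<psi>)
  then show ?case
    using h(1) by (simp add: min_of_mono strict_mono_mono)
next
  case (Imp \<phi> \<psi>)
  then show ?case
    using h by (simp add: godel_imp_def strict_mono_less_eq)
next
  case (Bel a \<phi>)
  let ?f = "\<lambda>s'. max (1 - acc M a s s') (fm_value M s' \<phi>)"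
  have "fm_value (rescale h M) s (Bel a \<phi>) = (INF s'\<in>states M. h (?f s'))"
    using Bel.IH h(1)
    by (simp add: rescale_def max_of_mono strict_mono_mono cong: INF_cong_simp)
  also have "\<dots> = Inf (h ` ?f ` states M)"
    by (simp add: image_image)
  also have "\<dots> = h (INF s'\<in>states M. ?f s')"
    by (rule continuous_at_Inf_mono[symmetric])
      (use h(1) Bel.prems Bel_bdd_below[OF M] continuous_at_imp_continuous_at_within[OF cont] in
        \<open>auto simp: strict_mono_mono\<close>)
  finally show ?case by simp
qed (use h in \<open>simp_all add: rescale_def\<close>)

text \<open>As \<open>X\<close> is finite, a gap separates the value of \<open>\<chi>\<close> from
  those of \<open>X\<close>; rescaling widens it to nearly all of [0,1].\<close>

lemma stretch:
  assumes M: "egl_model M" and s: "s \<in> states M" and "finite X"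
    and "\<And>\<psi>. \<psi> \<in> X \<Longrightarrow> fm_value M s \<chi> < fm_value M s \<psi>" and "fm_value M s \<chi> < 1"
    and \<epsilon>: "0 < \<epsilon>" "\<epsilon> < 1"
  obtains N :: "('s, 'p, 'a) egl" where "egl_model N" "s \<in> states N"
    "fm_value N s \<chi> \<le> \<epsilon>" "\<And>\<psi>. \<psi> \<in> X \<Longrightarrow> 1 - \<epsilon> \<le> fm_value N s \<psi>"
proof -
  define a where "a = fm_value M s \<chi>"
  \<comment> \<open>Inserting 1 covers an empty \<open>X\<close> and ensures
    \<open>b \<le> 1\<close>.\<close>
  define b where "b = Min (insert 1 (fm_value M s ` X))"
  \<comment> \<open>The clamped term is 0 up to \<open>a\<close> and 1 from \<open>b\<close> on; the
    small linear term makes \<open>h\<close> strictly increasing.\<close>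
  define h where "h x = \<epsilon> * x + (1 - \<epsilon>) * max 0 (min 1 ((x - a) / (b - a)))" for x
  have b: "b \<le> 1" "a < b" "\<And>\<psi>. \<psi> \<in> X \<Longrightarrow> b \<le> fm_value M s \<psi>"
    using assms(3-5) by (auto simp: a_def b_def)
  have a: "0 \<le> a" "a \<le> 1"
    using fm_value_bounds[OF M s, of \<chi>] by (auto simp: a_def)
  have h: "strict_mono h"
  proof (rule strict_monoI)
    fix x y :: real assume "x < y"
    moreover from this have "(x - a) / (b - a) \<le> (y - a) / (b - a)"
      using b(2) by (simp add: divide_right_mono)
    then have "(1 - \<epsilon>) * max 0 (min 1 ((x - a) / (b - a))) \<le> (1 - \<epsilon>) * max 0 (min 1 ((y - a) / (b - a)))"
      using \<epsilon> by (intro mult_left_mono) auto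
    ultimately show "h x < h y"
      using \<epsilon> unfolding h_def by (intro add_less_le_mono) auto
  qed
  have "- a / (b - a) \<le> 0" "1 \<le> (1 - a) / (b - a)"
    using a b by (auto simp: field_simps)
  then have h01: "h 0 = 0" "h 1 = 1"
    by (auto simp: h_def)
  have cont: "isCont h x" for x
    unfolding h_def using b(2) by (intro continuous_intros) auto
  let ?N = "rescale h M"
  have val: "fm_value ?N s \<phi> = h (fm_value M s \<phi>)" for \<phi>
    by (rule fm_value_rescale[OF M h h01 cont s])
  have "h a \<le> \<epsilon>"
    using a \<epsilon> by (simp add: h_def mult_left_le)
  moreover have "1 - \<epsilon> \<le> h b"
    using a b \<epsilon> by (simp add: h_def)
  then have "1 - \<epsilon> \<le> h (fm_value M s \<psi>)" if "\<psi> \<in> X" for \<psi>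
    using b(3)[OF that] h by (meson order_trans strict_mono_less_eq)
  ultimately show ?thesis
    using that[of ?N] rescale_model[OF M strict_mono_mono[OF h] h01] s
    by (simp add: val a_def)
qed

section \<open>Joining models under a new root\<close>

text \<open>
  The disjoint union of the models \<open>N i\<close> with a new root \<open>None\<close>, from which only the states \<open>w i\<close>
  are accessible.
\<close>

definition graft ::
  "'i set \<Rightarrow> ('i \<Rightarrow> ('s, 'p, 'a) egl) \<Rightarrow> ('i \<Rightarrow> 's) \<Rightarrow> ('a \<Rightarrow> 'i \<Rightarrow> real) \<Rightarrow> ('p \<Rightarrow> real)
    \<Rightarrow> (('i \<times> 's) option, 'p, 'a) egl" where
  "graft I N w \<rho> v = \<lparr>
     states = insert None (Some ` Sigma I (\<lambda>i. states (N i))),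
     acc = (\<lambda>a x y. case (x, y) of
         (None, Some (i, s)) \<Rightarrow> if s = w i then \<rho> a i else 0
       | (Some (i, s), Some (j, s')) \<Rightarrow> if i = j then acc (N i) a s s' else 0
       | _ \<Rightarrow> 0),
     val = (\<lambda>x. case x of None \<Rightarrow> v | Some (i, s) \<Rightarrow> val (N i) s)\<rparr>"

lemma graft_model:
  assumes "countable I" "\<And>i. i \<in> I \<Longrightarrow> egl_model (N i)"
    "\<And>a i. i \<in> I \<Longrightarrow> \<rho> a i \<in> {0..1}" "\<And>p. v p \<in> {0..1}"
  shows "egl_model (graft I N w \<rho> v)"
  using assms unfolding egl_model_def graft_def
  by (auto intro!: countable_SIGMA split: option.split)

text \<open>No state outside its own component is accessible from a state of
  \<open>N i\<close>.\<close>

lemma fm_value_graft: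
  assumes G: "egl_model (graft I N w \<rho> v)" and N: "\<And>i. i \<in> I \<Longrightarrow> egl_model (N i)"
    and "i \<in> I" "s \<in> states (N i)"
  shows "fm_value (graft I N w \<rho> v) (Some (i, s)) \<phi> = fm_value (N i) s \<phi>"
  using assms(3,4)
proof (induction \<phi> arbitrary: s)
  case (Bel a \<phi>)
  let ?G = "graft I N w \<rho> v"
  let ?f = "\<lambda>s'. max (1 - acc (N i) a s s') (fm_value (N i) s' \<phi>)"
  let ?g = "\<lambda>x. max (1 - acc ?G a (Some (i, s)) x) (fm_value ?G x \<phi>)"
  have gf: "?g (Some (i, s')) = ?f s'" if "s' \<in> states (N i)" for s'
    using Bel.IH[OF Bel.prems(1) that] by (simp add: graft_def)
  have sub: "Some (i, s') \<in> states ?G" if "s' \<in> states (N i)" for s'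
    using that Bel.prems by (simp add: graft_def)
  have "(INF x\<in>states ?G. ?g x) \<le> (INF s'\<in>states (N i). ?f s')"
  proof (rule cINF_mono[OF _ Bel_bdd_below[OF G]])
    show "\<exists>x\<in>states ?G. ?g x \<le> ?f s'" if "s' \<in> states (N i)" for s'
      using sub[OF that] gf[OF that] by (metis order_refl)
  qed (use Bel.prems in blast)
  moreover have "(INF s'\<in>states (N i). ?f s') \<le> (INF x\<in>states ?G. ?g x)"
  proof (rule cINF_greatest)
    fix x assume x: "x \<in> states ?G"
    show "(INF s'\<in>states (N i). ?f s') \<le> ?g x"
    proof (cases "\<exists>s'\<in>states (N i). x = Some (i, s')")
      case True
      then obtain s' where "s' \<in> states (N i)" "x = Some (i, s')"
        by blast
      then show ?thesis
        using cINF_lower[OF Bel_bdd_below[OF N[OF \<open>i \<in> I\<close>]], of s' a s \<phi>] by (simp add: gf)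
    next
      case False
      \<comment> \<open>Degree 0 makes the contribution at least 1, which bounds the infimum over
        \<open>N i\<close> from above.\<close>
      then have "acc ?G a (Some (i, s)) x = 0"
        using x by (auto simp: graft_def split: option.split)
      then show ?thesis
        using fm_value_bounds[OF N[OF \<open>i \<in> I\<close>] Bel.prems(2), of "Bel a \<phi>"]
        by (auto simp: le_max_iff_disj)
    qed
  qed (use G in \<open>simp add: egl_model_def\<close>)
  ultimately show ?case by simp
qed (simp_all add: graft_def)

section \<open>Completeness\<close>

primrec modal_depth :: "('p, 'a) fm \<Rightarrow> nat" where
  "modal_depth (Atom p) = 0"
| "modal_depth Bot = 0"
| "modal_depth (And \<phi> \<psi>) = max (modal_depth \<phi>) (modal_depth \<psi>)"
| "modal_depth (Imp \<phi> \<psi>) = max (modal_depth \<phi>) (modal_depth \<psi>)"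
| "modal_depth (Bel a \<phi>) = Suc (modal_depth \<phi>)"

lemma modal_depth_prims: "Bel a \<psi> \<in> prims \<phi> \<Longrightarrow> modal_depth \<psi> < modal_depth \<phi>"
  by (induction \<phi>) auto

lemma modal_depth_Imps:
  "modal_depth (Imps \<psi>s \<chi>) < n \<longleftrightarrow> (\<forall>\<psi>\<in>insert \<chi> (set \<psi>s). modal_depth \<psi> < n)"
  by (induction \<psi>s) auto

text \<open>\<open>gval_Imps\<close> read at a state that refutes the chain of implications.\<close>

lemma not_valid_ImpsE:
  fixes \<chi> :: "('p, 'a) fm"
  assumes "\<not> valid (Imps \<psi>s \<chi>)"
  obtains M :: "(nat, 'p, 'a) egl" and s where "egl_model M" "s \<in> states M" "fm_value M s \<chi> < 1"
    "\<And>\<psi>. \<psi> \<in> set \<psi>s \<Longrightarrow> fm_value M s \<chi> < fm_value M s \<psi>"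
proof -
  obtain M :: "(nat, 'p, 'a) egl" and s
    where M: "egl_model M" "s \<in> states M" "fm_value M s (Imps \<psi>s \<chi>) \<noteq> 1"
    using assms unfolding valid_def true_in_def by blast
  have bound: "gval (fm_value M s) \<psi> \<le> 1" for \<psi>
    using fm_value_bounds[OF M(1,2), of \<psi>] by (simp flip: fm_value_gval)
  have "(if \<exists>\<psi>\<in>set \<psi>s. fm_value M s \<psi> \<le> fm_value M s \<chi> then 1 else fm_value M s \<chi>) \<noteq> 1"
    using M(3) gval_Imps[OF bound, of \<psi>s \<chi>] unfolding fm_value_gval[symmetric] by simp
  then have *: "\<not> (\<exists>\<psi>\<in>set \<psi>s. fm_value M s \<psi> \<le> fm_value M s \<chi>)" "fm_value M s \<chi> \<noteq> 1"
    by (auto split: if_splits)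
  then show ?thesis
    using that[OF M(1,2)] fm_value_bounds[OF M(1,2), of \<chi>] by force
qed

lemma refuting_valuation:
  fixes \<phi> :: "('p, 'a) fm"
  assumes "\<not> KF_provable \<phi>"
    and IH: "\<And>\<psi> :: ('p, 'a) fm. modal_depth \<psi> < modal_depth \<phi> \<Longrightarrow> valid \<psi> \<Longrightarrow> KF_provable \<psi>"
  obtains v :: "('p, 'a) fm \<Rightarrow> real" where "range v \<subseteq> {0..1}" "gval v \<phi> < 1"
    "\<And>a \<chi> \<psi>s. Bel a \<chi> \<in> prims \<phi> \<Longrightarrow> v (Bel a \<chi>) \<le> gval v \<phi> \<Longrightarrow> distinct \<psi>s \<Longrightarrow>
      (\<And>\<psi>. \<psi> \<in> set \<psi>s \<Longrightarrow> Bel a \<psi> \<in> prims \<phi> \<and> v (Bel a \<chi>) < v (Bel a \<psi>)) \<Longrightarrow>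
      \<not> valid (Imps \<psi>s \<chi>)"
proof -
  define A where "A = {\<psi>. \<exists>a. Bel a \<psi> \<in> prims \<phi>}"
  \<comment> \<open>Distinctness leaves finitely many lists over the finite set \<open>A\<close>,
    hence finitely many premises \<open>\<Gamma>\<close>. A list may mix bodies boxed by other
    agents; the resulting premises are theorems all the same.\<close>
  define C where "C = {(a, \<chi>, \<psi>s). Bel a \<chi> \<in> prims \<phi> \<and> set \<psi>s \<subseteq> A \<and> distinct \<psi>s \<and> valid (Imps \<psi>s \<chi>)}"
  define \<Gamma> where "\<Gamma> = (\<lambda>(a, \<chi>, \<psi>s). Imps (map (Bel a) \<psi>s) (Bel a \<chi>)) ` C"
  define P where "P = {(a, \<chi>). Bel a \<chi> \<in> prims \<phi>}"
  have P: "finite P"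
    unfolding P_def by (rule finite_boxes)
  have "A = snd ` P"
    by (force simp: A_def P_def)
  then have A: "finite A"
    using P by simp
  have "C \<subseteq> (\<lambda>((a, \<chi>), \<psi>s). (a, \<chi>, \<psi>s)) ` (P \<times> {\<psi>s. set \<psi>s \<subseteq> A \<and> distinct \<psi>s})"
  proof clarify
    fix a \<chi> \<psi>s assume "(a, \<chi>, \<psi>s) \<in> C"
    then have "((a, \<chi>), \<psi>s) \<in> P \<times> {\<psi>s. set \<psi>s \<subseteq> A \<and> distinct \<psi>s}"
      by (simp add: C_def P_def)
    then show "(a, \<chi>, \<psi>s) \<in> (\<lambda>((a, \<chi>), \<psi>s). (a, \<chi>, \<psi>s)) ` (P \<times> {\<psi>s. set \<psi>s \<subseteq> A \<and> distinct \<psi>s})"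
      by (rule rev_image_eqI) simp
  qed
  then have "finite C"
    by (rule finite_subset) (intro finite_imageI finite_cartesian_product P finite_subset_distinct A)
  then have "finite \<Gamma>"
    unfolding \<Gamma>_def by (rule finite_imageI)
  then obtain \<gamma>s where \<gamma>s: "set \<gamma>s = \<Gamma>"
    using finite_list by blast
  have "KF_provable (Imps (map (Bel a) \<psi>s) (Bel a \<chi>))" if "(a, \<chi>, \<psi>s) \<in> C" for a \<chi> \<psi>s
  proof -
    have "modal_depth (Imps \<psi>s \<chi>) < modal_depth \<phi>"
      using that unfolding modal_depth_Imps by (auto simp: C_def A_def dest: modal_depth_prims)
    moreover have "valid (Imps \<psi>s \<chi>)"
      using that by (simp add: C_def)
    ultimately show ?thesis
      using IH by (blast intro: KF_provable_mp[OF KF_provable_Bel_Imps KF_provable_nec])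
  qed
  then have "KF_provable \<gamma>" if "\<gamma> \<in> set \<gamma>s" for \<gamma>
    using that by (auto simp: \<gamma>s \<Gamma>_def)
  then have "\<not> KF_provable (Imps \<gamma>s \<phi>)"
    using assms(1) KF_provable_Imps_mp by blast
  \<comment> \<open>By \<open>gval_Imps\<close>, such a \<open>v\<close> puts \<open>\<phi>\<close>
    below 1 and all of \<open>\<Gamma>\<close> above \<open>\<phi>\<close>.\<close>
  then obtain v where v: "range v \<subseteq> {0..1}" "gval v (Imps \<gamma>s \<phi>) \<noteq> 1"
    using KF_provable_gval by blast
  have "(if \<exists>\<gamma>\<in>\<Gamma>. gval v \<gamma> \<le> gval v \<phi> then 1 else gval v \<phi>) \<noteq> 1"
    using v(2) unfolding gval_Imps[OF gval_le_1[OF v(1)]] \<gamma>s .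
  then have nle: "\<not> (\<exists>\<gamma>\<in>\<Gamma>. gval v \<gamma> \<le> gval v \<phi>)" and "gval v \<phi> \<noteq> 1"
    by (auto split: if_splits)
  then have "gval v \<phi> < 1"
    using gval_le_1[OF v(1), of \<phi>] by simp
  moreover have "\<not> valid (Imps \<psi>s \<chi>)"
    if \<chi>: "Bel a \<chi> \<in> prims \<phi>" "v (Bel a \<chi>) \<le> gval v \<phi>" and "distinct \<psi>s"
      and \<psi>s: "\<And>\<psi>. \<psi> \<in> set \<psi>s \<Longrightarrow> Bel a \<psi> \<in> prims \<phi> \<and> v (Bel a \<chi>) < v (Bel a \<psi>)" for a \<chi> \<psi>s
  proof
    assume "valid (Imps \<psi>s \<chi>)"
    moreover have "set \<psi>s \<subseteq> A"
      using \<psi>s by (auto simp: A_def)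
    ultimately have "Imps (map (Bel a) \<psi>s) (Bel a \<chi>) \<in> \<Gamma>"
      unfolding \<Gamma>_def using \<chi>(1) \<open>distinct \<psi>s\<close>
      by (intro image_eqI[of _ _ "(a, \<chi>, \<psi>s)"]) (auto simp: C_def)
    then have "gval v \<phi> < gval v (Imps (map (Bel a) \<psi>s) (Bel a \<chi>))"
      using nle by (meson not_le)
    \<comment> \<open>All premises exceed the conclusion, so the chain takes the conclusion's value,
      which is at most \<open>gval v \<phi>\<close>.\<close>
    also have "\<dots> = v (Bel a \<chi>)"
    proof -
      have "\<forall>\<psi>\<in>set \<psi>s. \<not> v (Bel a \<psi>) \<le> v (Bel a \<chi>)"
        using \<psi>s by (meson not_le)
      then show ?thesis
        by (subst gval_Imps[OF gval_le_1[OF v(1)]]) simp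
    qed
    finally show False
      using \<chi>(2) by simp
  qed
  ultimately show ?thesis
    using that v(1) by blast
qed

section \<open>Construction of the countermodel\<close>

theorem KF_complete:
  fixes \<phi> :: "('p, 'a) fm"
  assumes "valid \<phi>"
  shows "KF_provable \<phi>"
  using assms
proof (induction "modal_depth \<phi>" arbitrary: \<phi> rule: less_induct)
  case less
  show ?case
  proof (rule ccontr)
    assume "\<not> KF_provable \<phi>"
    then obtain v where v: "range v \<subseteq> {0..1}" and lt1: "gval v \<phi> < 1"
      and inv: "\<And>a \<chi> \<psi>s. Bel a \<chi> \<in> prims \<phi> \<Longrightarrow> v (Bel a \<chi>) \<le> gval v \<phi> \<Longrightarrow> distinct \<psi>s \<Longrightarrow>
        (\<And>\<psi>. \<psi> \<in> set \<psi>s \<Longrightarrow> Bel a \<psi> \<in> prims \<phi> \<and> v (Bel a \<chi>) < v (Bel a \<psi>)) \<Longrightarrow>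
        \<not> valid (Imps \<psi>s \<chi>)"
      using refuting_valuation less.hyps by metis
    define t where "t = gval v \<phi>"
    \<comment> \<open>A null sequence with
      \<open>1 - \<epsilon> n \<ge> (1 + t) / 2 > t\<close>.\<close>
    define \<epsilon> where "\<epsilon> n = (1 - t) / 2 / Suc n" for n
    \<comment> \<open>Only boxes of value at most \<open>t\<close> must be matched exactly; the
      others need only stay above \<open>t\<close>.\<close>
    define J where "J = {(a, \<chi>). Bel a \<chi> \<in> prims \<phi> \<and> v (Bel a \<chi>) \<le> t}"
    \<comment> \<open>One submodel for each precision \<open>\<epsilon> n\<close>: a box of value 0
      is reached only as an infimum over all \<open>n\<close>.\<close>
    define I where "I = J \<times> (UNIV :: nat set)"
    define X where "X a \<chi> = {\<psi>. Bel a \<psi> \<in> prims \<phi> \<and> v (Bel a \<chi>) < v (Bel a \<psi>)}" for a \<chi>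
    have t: "0 \<le> t" "t < 1"
      using gval_bounds[OF v, of \<phi>] lt1 by (auto simp: t_def)
    have \<epsilon>: "0 < \<epsilon> n" "\<epsilon> n < 1" "\<epsilon> n \<le> (1 - t) / 2" for n
      using t mult_nonneg_nonneg[of "1 - t" "real n"] by (auto simp: \<epsilon>_def field_simps)
    have v01: "v \<psi> \<in> {0..1}" for \<psi>
      using v by blast
    have "\<exists>N :: (nat, 'p, 'a) egl. \<exists>w. egl_model N \<and> w \<in> states N \<and> fm_value N w \<chi> \<le> \<epsilon> n \<and>
        (\<forall>\<psi>\<in>X a \<chi>. 1 - \<epsilon> n \<le> fm_value N w \<psi>)"
      if "(a, \<chi>) \<in> J" for a \<chi> n
    proof -
      have "X a \<chi> \<subseteq> snd ` {(a, \<psi>). Bel a \<psi> \<in> prims \<phi>}"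
        by (force simp: X_def)
      then have X: "finite (X a \<chi>)"
        by (rule finite_subset) (intro finite_imageI finite_boxes)
      then obtain \<psi>s where \<psi>s: "set \<psi>s = X a \<chi>" "distinct \<psi>s"
        using finite_distinct_list by blast
      have "\<not> valid (Imps \<psi>s \<chi>)"
        using that \<psi>s by (intro inv[of a]) (auto simp: J_def t_def X_def)
      then obtain M :: "(nat, 'p, 'a) egl" and s
        where M: "egl_model M" "s \<in> states M" "fm_value M s \<chi> < 1"
          "\<And>\<psi>. \<psi> \<in> X a \<chi> \<Longrightarrow> fm_value M s \<chi> < fm_value M s \<psi>"
        by (rule not_valid_ImpsE) (use \<psi>s in auto)
      show ?thesis
        using stretch[OF M(1,2) X M(4,3) \<epsilon>(1,2)[of n]] by metis
    qed
    then have "\<forall>i\<in>I. \<exists>N :: (nat, 'p, 'a) egl. \<exists>w. egl_model N \<and> w \<in> states N \<and>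
        fm_value N w (snd (fst i)) \<le> \<epsilon> (snd i) \<and>
        (\<forall>\<psi>\<in>X (fst (fst i)) (snd (fst i)). 1 - \<epsilon> (snd i) \<le> fm_value N w \<psi>)"
      by (auto simp: I_def)
    then obtain N :: "_ \<Rightarrow> (nat, 'p, 'a) egl" and w where
      N_props: "\<forall>i\<in>I. egl_model (N i) \<and> w i \<in> states (N i) \<and>
        fm_value (N i) (w i) (snd (fst i)) \<le> \<epsilon> (snd i) \<and>
        (\<forall>\<psi>\<in>X (fst (fst i)) (snd (fst i)). 1 - \<epsilon> (snd i) \<le> fm_value (N i) (w i) \<psi>)"
      by metis
    have N: "egl_model (N i)" "w i \<in> states (N i)" if "i \<in> I" for i
      using N_props that by auto
    have Nle: "fm_value (N ((a, \<chi>), n)) (w ((a, \<chi>), n)) \<chi> \<le> \<epsilon> n" if "(a, \<chi>) \<in> J" for a \<chi> n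
      using bspec[OF N_props, of "((a, \<chi>), n)"] that by (simp add: I_def)
    have Nge: "1 - \<epsilon> n \<le> fm_value (N ((a, \<chi>), n)) (w ((a, \<chi>), n)) \<psi>"
      if "(a, \<chi>) \<in> J" "\<psi> \<in> X a \<chi>" for a \<chi> \<psi> n
      using bspec[OF N_props, of "((a, \<chi>), n)"] that by (simp add: I_def)
    \<comment> \<open>Witnesses for a box of agent \<open>b\<close> are seen by \<open>b\<close>
      alone, and keep their contribution to any box at the root at least
      \<open>v (Bel b \<chi>)\<close>.\<close>
    define \<rho> where "\<rho> a = (\<lambda>((b, \<chi>), n :: nat). if a = b then 1 - v (Bel b \<chi>) else 0)" for a
    let ?G = "graft I N w \<rho> (\<lambda>p. v (Atom p))"
    have "J \<subseteq> {(a, \<psi>). Bel a \<psi> \<in> prims \<phi>}"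
      by (auto simp: J_def)
    then have "countable I"
      unfolding I_def using finite_boxes countable_finite finite_subset by blast
    then have G: "egl_model ?G"
      by (rule graft_model) (use N(1) v01 in \<open>auto simp: \<rho>_def\<close>)
    have fm_N: "fm_value ?G (Some (i, s)) \<psi> = fm_value (N i) s \<psi>"
      if "i \<in> I" "s \<in> states (N i)" for i s \<psi>
      using fm_value_graft[OF G N(1) that] .
    have root: "None \<in> states ?G"
      by (simp add: graft_def)
    have box: "fm_value ?G None (Bel a \<psi>) = v (Bel a \<psi>) \<or>
        t < fm_value ?G None (Bel a \<psi>) \<and> t < v (Bel a \<psi>)"
      if \<psi>: "Bel a \<psi> \<in> prims \<phi>" for a \<psi>
    proof -
      let ?g = "\<lambda>x. max (1 - acc ?G a None x) (fm_value ?G x \<psi>)"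
      \<comment> \<open>The cap \<open>(1 + t) / 2\<close> exceeds \<open>t\<close>, so it alters no
        value up to \<open>t\<close> and leaves larger ones above \<open>t\<close>.\<close>
      have lower: "min (v (Bel a \<psi>)) ((1 + t) / 2) \<le> (INF x\<in>states ?G. ?g x)"
      proof (rule cINF_greatest)
        fix x assume x: "x \<in> states ?G"
        show "min (v (Bel a \<psi>)) ((1 + t) / 2) \<le> ?g x"
        proof (cases "\<exists>\<chi> n. (a, \<chi>) \<in> J \<and> x = Some (((a, \<chi>), n), w ((a, \<chi>), n))")
          case True
          then obtain \<chi> n where \<chi>: "(a, \<chi>) \<in> J" and x_eq: "x = Some (((a, \<chi>), n), w ((a, \<chi>), n))"
            by blast
          have i: "((a, \<chi>), n) \<in> I"
            using \<chi> by (simp add: I_def)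
          have "?g x = max (v (Bel a \<chi>)) (fm_value (N ((a, \<chi>), n)) (w ((a, \<chi>), n)) \<psi>)"
            using fm_N[OF i N(2)[OF i]] by (simp add: x_eq graft_def \<rho>_def)
          \<comment> \<open>Otherwise \<open>v (Bel a \<psi>) \<le> v (Bel a \<chi>)\<close>, and
            the degree of access alone gives the bound.\<close>
          moreover have "(1 + t) / 2 \<le> fm_value (N ((a, \<chi>), n)) (w ((a, \<chi>), n)) \<psi>"
            if "v (Bel a \<chi>) < v (Bel a \<psi>)"
            using Nge[OF \<chi>, of \<psi> n] \<psi> that \<epsilon>(3)[of n] by (simp add: X_def field_simps)
          ultimately show ?thesis
            by (auto simp: min_le_iff_disj le_max_iff_disj not_le)
        next
          case False
          then have "acc ?G a None x = 0"
            using x by (auto simp: graft_def \<rho>_def I_def split: option.split)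
          then show ?thesis
            using v01[of "Bel a \<psi>"] by (auto simp: min_le_iff_disj le_max_iff_disj)
        qed
      qed (use root in blast)
      \<comment> \<open>The states made for \<open>(a, \<psi>)\<close> itself contribute at most
        \<open>max (v (Bel a \<psi>)) (\<epsilon> n)\<close>; then \<open>n\<close> tends to
        infinity.\<close>
      have upper: "(INF x\<in>states ?G. ?g x) \<le> v (Bel a \<psi>)" if "v (Bel a \<psi>) \<le> t"
      proof -
        have J: "(a, \<psi>) \<in> J"
          using \<psi> that by (simp add: J_def)
        have le: "(INF x\<in>states ?G. ?g x) \<le> max (v (Bel a \<psi>)) (\<epsilon> n)" for n
        proof -
          let ?i = "((a, \<psi>), n)"
          have i: "?i \<in> I"
            using J by (simp add: I_def)
          then have "Some (?i, w ?i) \<in> states ?G"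
            using N(2)[OF i] by (simp add: graft_def)
          then have "(INF x\<in>states ?G. ?g x) \<le> ?g (Some (?i, w ?i))"
            by (intro cINF_lower Bel_bdd_below G)
          also have "\<dots> = max (v (Bel a \<psi>)) (fm_value (N ?i) (w ?i) \<psi>)"
            using fm_N[OF i N(2)[OF i]] by (simp add: graft_def \<rho>_def)
          also have "\<dots> \<le> max (v (Bel a \<psi>)) (\<epsilon> n)"
            using Nle[OF J] by (intro max.mono) auto
          finally show ?thesis .
        qed
        have "\<epsilon> \<longlonglongrightarrow> 0"
          unfolding \<epsilon>_def divide_inverse[of _ "real (Suc _)"]
          by (intro tendsto_mult_right_zero LIMSEQ_inverse_real_of_nat)
        then have "(\<lambda>n. max (v (Bel a \<psi>)) (\<epsilon> n)) \<longlonglongrightarrow> max (v (Bel a \<psi>)) 0"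
          by (intro tendsto_intros)
        then have "(INF x\<in>states ?G. ?g x) \<le> max (v (Bel a \<psi>)) 0"
          by (rule LIMSEQ_le_const) (use le in blast)
        then show ?thesis
          using v01[of "Bel a \<psi>"] by simp
      qed
      have "v (Bel a \<psi>) \<le> t \<Longrightarrow> min (v (Bel a \<psi>)) ((1 + t) / 2) = v (Bel a \<psi>)"
        and "t < v (Bel a \<psi>) \<Longrightarrow> t < min (v (Bel a \<psi>)) ((1 + t) / 2)"
        using t by (simp_all add: field_simps)
      then show ?thesis
        using lower upper unfolding fm_value.simps by linarith
    qed
    have "fm_value ?G None \<psi> = v \<psi> \<or> t < fm_value ?G None \<psi> \<and> t < v \<psi>" if "\<psi> \<in> prims \<phi>" for \<psi>
    proof (cases \<psi>)
      case (Atom p)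
      then show ?thesis by (simp add: graft_def)
    next
      case (Bel a \<chi>)
      then show ?thesis using box that by blast
    qed (use that prims_cases[OF that] in auto)
    \<comment> \<open>The other alternative of \<open>gval_collapse\<close> would require
      \<open>t < gval v \<phi>\<close>, but these are equal.\<close>
    then have "gval (fm_value ?G None) \<phi> = t"
      using gval_collapse[of \<phi> "fm_value ?G None" v t] t by (auto simp: t_def)
    then have "fm_value ?G None \<phi> < 1"
      using t by (simp flip: fm_value_gval)
    then show False
      \<comment> \<open>The states of \<open>?G\<close> are not natural numbers, so validity is
        first transferred to their type.\<close>
      using valid_true_in[OF less.prems G] root by (force simp: true_in_def)
  qed
qed

theorem theorem3p2:
  fixes \<phi> :: "('p, 'a) fm"
  assumes "valid \<phi>"
  shows "KF_provable (Neg (Neg \<phi>))"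
proof (rule KF_provable_mp[OF _ KF_complete[OF assms]])
  show "KF_provable (Imp \<phi> (Neg (Neg \<phi>)))"
    by (rule KF_provable_gval) (simp add: godel_imp_def)
qed

end
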